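(* Let $\Omega$ be a Hausdorff space, let $g$ be a non-negative, continuous negative definite kernel on $\Omega\times\Omega$, and let $h$ be a monotonically decreasing convex differentiable function on $\mathbb{R}^+$. Then the scoring rule $$S^h_g(\mathbb{P},y) := h\left(\mathsf{E}_{\mathbb{P},\mathbb{P}}[g(X,Y)]\right) + 2h'\left(\mathsf{E}_{\mathbb{P},\mathbb{P}}[g(X,Y)]\right)\left(\mathsf{E}_{\mathbb{P}}[g(X,y)] - \mathsf{E}_{\mathbb{P},\mathbb{P}}[g(X,Y)]\right)$$ is proper on the class of Borel probability measures $\mathbb{P}$ on $\Omega$ which satisfy $\mathsf{E}_{\mathbb{P},\mathbb{P}}[g(X,Y)]<\infty$ (and for which $\mathsf{E}_{\mathbb{P},\mathbb{P}}[g(X,Y)]$ lies in the domain $\mathbb{R}^+$ of $h$, so that the score is defined).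
   Context: A negative definite kernel on a non-empty set $\Omega$ is a real-valued function $g$ on $\Omega\times\Omega$ that is symmetric in its arguments and satisfies $\sum_{i=1}^n\sum_{j=1}^n a_ia_jg(x_i,x_j)\le 0$ for all positive integers $n$, all $a_1,\dots,a_n\in\mathbb{R}$ with $\sum_i a_i=0$ and all $x_1,\dots,x_n\in\Omega$. $\mathsf{E}_{\mathbb{P}}[g(X,y)]$ is the expectation for $X\sim\mathbb{P}$, and $\mathsf{E}_{\mathbb{P},\mathbb{Q}}[g(X,Y)]$ is the expectation for independent $X\sim\mathbb{P}$ and $Y\sim\mathbb{Q}$. For a scoring rule $S(\mathbb{P},y)$, write $S(\mathbb{P},\mathbb{Q})$ for the expected value of $S(\mathbb{P},Y)$ when $Y\sim\mathbb{Q}$. $S$ is proper on a class $\mathcal{P}$ of probability measures if $S(\mathbb{Q},\mathbb{Q})\ge S(\mathbb{P},\mathbb{Q})$ for all $\mathbb{P},\mathbb{Q}\in\mathcal{P}$. $\mathbb{R}^+$ denotes the positive half-line. *)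

theory Defs
  imports "HOL-Probability.Probability"
begin

definition negative_definite_kernel :: "('a \<Rightarrow> 'a \<Rightarrow> real) \<Rightarrow> bool" where
  "negative_definite_kernel g \<longleftrightarrow>
     (\<forall>x y. g x y = g y x) \<and>
     (\<forall>(n::nat) (a :: nat \<Rightarrow> real) (x :: nat \<Rightarrow> 'a).
        0 < n \<longrightarrow> (\<Sum>i<n. a i) = 0 \<longrightarrow>
        (\<Sum>i<n. \<Sum>j<n. a i * a j * g (x i) (x j)) \<le> 0)"

definition borel_prob_measures :: "'a::topological_space measure set" where
  "borel_prob_measures = {P. prob_space P \<and> sets P = sets borel}"

(* The expectation of g(X,Y) for independent X ~ P and Y ~ Q, for non-negative g.
   On a space that is not second countable, a continuous g need not be measurable for the
   product sigma-algebra of the two Borel sigma-algebras (only its sections are Borel), so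
   the integral over the product measure is not always available.  The iterated integral
   only uses the sections; the two lemmas that follow show that it is the integral over the
   product measure, and the expectation for independent random variables, whenever g is
   product measurable. *)
definition pair_expectation ::
  "('a \<Rightarrow> 'a \<Rightarrow> real) \<Rightarrow> 'a measure \<Rightarrow> 'a measure \<Rightarrow> ennreal" where
  "pair_expectation g P Q = (\<integral>\<^sup>+ y. (\<integral>\<^sup>+ x. ennreal (g x y) \<partial>P) \<partial>Q)"

lemma pair_expectation_eq_product:
  assumes P: "prob_space P" and Q: "prob_space Q"
    and g: "case_prod g \<in> borel_measurable (P \<Otimes>\<^sub>M Q)"
  shows "pair_expectation g P Q = (\<integral>\<^sup>+ z. ennreal (case_prod g z) \<partial>(P \<Otimes>\<^sub>M Q))"
proof -
  interpret P: prob_space P by fact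
  interpret Q: prob_space Q by fact
  interpret pair_sigma_finite P Q ..
  show ?thesis
    using nn_integral_snd[of "\<lambda>z. ennreal (case_prod g z)"] g
    by (simp add: pair_expectation_def)
qed

lemma pair_expectation_eq_indep:
  assumes M: "prob_space M"
    and ind: "prob_space.indep_var M borel X borel Y"
    and g: "case_prod g \<in> borel_measurable (borel \<Otimes>\<^sub>M borel)"
  shows "pair_expectation g (distr M borel X) (distr M borel Y) =
         (\<integral>\<^sup>+ \<omega>. ennreal (g (X \<omega>) (Y \<omega>)) \<partial>M)"
proof -
  interpret M: prob_space M by fact
  have X[measurable]: "X \<in> measurable M borel" and Y[measurable]: "Y \<in> measurable M borel"
    and joint: "distr M borel X \<Otimes>\<^sub>M distr M borel Y =
                distr M (borel \<Otimes>\<^sub>M borel) (\<lambda>\<omega>. (X \<omega>, Y \<omega>))"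
    using ind unfolding M.indep_var_distribution_eq by auto
  have g': "case_prod g \<in> borel_measurable (distr M borel X \<Otimes>\<^sub>M distr M borel Y)"
    using g unfolding joint by simp
  have "pair_expectation g (distr M borel X) (distr M borel Y) =
        (\<integral>\<^sup>+ z. ennreal (case_prod g z) \<partial>distr M (borel \<Otimes>\<^sub>M borel) (\<lambda>\<omega>. (X \<omega>, Y \<omega>)))"
    using pair_expectation_eq_product[OF M.prob_space_distr[OF X] M.prob_space_distr[OF Y] g']
    by (simp only: joint)
  also have "\<dots> = (\<integral>\<^sup>+ \<omega>. ennreal (g (X \<omega>) (Y \<omega>)) \<partial>M)"
    using g by (subst nn_integral_distr) auto
  finally show ?thesis .
qed

definition kernel_score ::
  "(real \<Rightarrow> real) \<Rightarrow> ('a \<Rightarrow> 'a \<Rightarrow> real) \<Rightarrow> 'a measure \<Rightarrow> 'a \<Rightarrow> real" where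
  "kernel_score h g P y =
     (let e = enn2real (pair_expectation g P P)
      in h e + 2 * deriv h e * ((\<integral>x. g x y \<partial>P) - e))"

definition expected_score :: "('a measure \<Rightarrow> 'a \<Rightarrow> real) \<Rightarrow> 'a measure \<Rightarrow> 'a measure \<Rightarrow> real" where
  "expected_score S P Q = (\<integral>y. S P y \<partial>Q)"

(* The integrability conjunct says that the expected scores exist; without it the inequality
   could hold or fail because of the default value 0 of the integral. *)
definition proper_scoring_rule :: "('a measure \<Rightarrow> 'a \<Rightarrow> real) \<Rightarrow> 'a measure set \<Rightarrow> bool" where
  "proper_scoring_rule S \<P> \<longleftrightarrow>
     (\<forall>P\<in>\<P>. \<forall>Q\<in>\<P>. integrable Q (S P) \<and> expected_score S P Q \<le> expected_score S Q Q)"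

(* The integral of g x y with respect to x in the score is never a default value either. *)
lemma integrable_kernel_section:
  fixes g :: "'a::topological_space \<Rightarrow> 'a \<Rightarrow> real"
  assumes P: "P \<in> borel_prob_measures" and nonneg: "\<And>x y. 0 \<le> g x y"
    and cont: "continuous_on UNIV (\<lambda>(x, y). g x y)"
    and nd: "negative_definite_kernel g"
    and fin: "pair_expectation g P P < \<infinity>"
  shows "integrable P (\<lambda>x. g x y)"
proof -
  interpret P: prob_space P using P by (simp add: borel_prob_measures_def)
  have sets: "sets P = sets borel" using P by (simp add: borel_prob_measures_def)
  have meas: "(\<lambda>x. g x z) \<in> borel_measurable P" for z
  proof -
    have "continuous_on UNIV (\<lambda>x. g x z)"
      using continuous_on_compose2[OF cont continuous_on_Pair[OF continuous_on_id continuous_on_const]]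
      by simp
    then show ?thesis
      using measurable_cong_sets[OF sets refl] borel_measurable_continuous_onI by blast
  qed
  obtain z where z: "(\<integral>\<^sup>+ x. ennreal (g x z) \<partial>P) < \<infinity>"
  proof (rule ccontr)
    assume "\<not> thesis"
    then have "(\<integral>\<^sup>+ x. ennreal (g x z) \<partial>P) = \<infinity>" for z
      using that[of z] by (cases "(\<integral>\<^sup>+ x. ennreal (g x z) \<partial>P) = \<infinity>") (simp_all add: less_top)
    then have "pair_expectation g P P = \<infinity>"
      by (simp add: pair_expectation_def P.emeasure_space_1)
    with fin show False by simp
  qed
  have int: "integrable P (\<lambda>x. g x z)"
    using z meas nonneg by (intro integrableI_nonneg) auto
  have bound: "g x y \<le> 2 * g x z + 2 * g y z" for x
  proof -
    define a :: "nat \<Rightarrow> real" where "a = (\<lambda>i. if i = 2 then -2 else 1)"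
    define p where "p = (\<lambda>i::nat. if i = 0 then x else if i = 1 then y else z)"
    have "(\<Sum>i<3. a i) = 0" by (simp add: a_def eval_nat_numeral)
    then have "(\<Sum>i<3. \<Sum>j<3. a i * a j * g (p i) (p j)) \<le> 0"
      using nd[unfolded negative_definite_kernel_def, THEN conjunct2, rule_format, of 3 a p] by simp
    moreover have "(\<Sum>i<3. \<Sum>j<3. a i * a j * g (p i) (p j)) =
        g x x + g y y + 4 * g z z + g x y + g y x - 2 * g x z - 2 * g z x - 2 * g y z - 2 * g z y"
      by (simp add: a_def p_def eval_nat_numeral)
    moreover have "g y x = g x y" "g z x = g x z" "g z y = g y z"
      using nd by (auto simp: negative_definite_kernel_def)
    ultimately show ?thesis
      using nonneg[of x x] nonneg[of y y] nonneg[of z z] by linarith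
  qed
  show ?thesis
    by (rule Bochner_Integration.integrable_bound[of P "\<lambda>x. 2 * g x z + 2 * g y z"])
       (use int meas bound nonneg in \<open>auto simp: abs_of_nonneg intro!: AE_I2\<close>)
qed

end

theory Submission
  imports Defs
begin

text \<open>Write \<open>e P Q\<close> for the expectation of \<open>g\<close> under independent draws from \<open>P\<close> and \<open>Q\<close>.  The
  expected score of \<open>P\<close> under \<open>Q\<close> is \<open>h (e P P) + 2 h' (e P P) (e P Q - e P P)\<close>, and that of \<open>Q\<close>
  under \<open>Q\<close> is \<open>h (e Q Q)\<close>.  The kernel contributes a single inequality to the proof, the
  non-negativity of the energy distance, \<open>e P P + e Q Q \<le> 2 e P Q\<close> (\<open>energy_distance_nonneg\<close>).  Since
  \<open>h' \<le> 0\<close>, it bounds the first score by \<open>h (e P P) + h' (e P P) (e Q Q - e P P)\<close>, the value at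
  \<open>e Q Q\<close> of the tangent to \<open>h\<close> at \<open>e P P\<close>, and a convex function lies above its tangents
  (\<open>antimono_convex_tangent_bound\<close>).

  The energy distance inequality is an averaged form of negative definiteness.  Take \<open>n\<close> points
  of weight 1 drawn from \<open>P\<close> and \<open>n\<close> points of weight -1 drawn from \<open>Q\<close>, all independent.
  The weights sum to zero, so the quadratic form of \<open>g\<close> is never positive; its expectation is
  \<open>n (n - 1) (e P P + e Q Q) - 2 n\<^sup>2 e P Q\<close> plus \<open>n\<close> times a constant that comes from the diagonal
  of \<open>g\<close>.  Dividing by \<open>n\<^sup>2\<close> and letting \<open>n\<close> grow gives the claim.

  A continuous kernel need not be measurable for the product of the Borel sigma-algebras, and
  Fubini's theorem is then not available.  The expectation is therefore computed as an iterated
  integral, one point at a time: every point from \<open>P\<close> is integrated before every point from \<open>Q\<close>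
  (\<open>average_many_points\<close>), and so the mixed terms only occur in the order of integration that
  the score prescribes.  The inner integrals \<open>potential g P\<close> are continuous functions
  (\<open>continuous_potential\<close>), hence Borel measurable.  Dominated convergence would
  only give sequential continuity, which does not suffice on a general space; continuity follows from negative definiteness, which
  controls the modulus of continuity of all sections of \<open>g\<close> simultaneously
  (\<open>increment_bound\<close>).\<close>

section \<open>Quadratic forms of finite weighted configurations\<close>

text \<open>A list of pairs of a weight and a point stands for a finitely supported signed measure \<open>v\<close>.
  The function \<open>pairing w v\<close> is the integral of \<open>w\<close> with respect to \<open>v\<close>.  Lists make adding a
  point to a configuration a mere Cons.\<close>

definition pairing :: "('a \<Rightarrow> real) \<Rightarrow> (real \<times> 'a) list \<Rightarrow> real" where
  "pairing w v = (\<Sum>(b, y)\<leftarrow>v. b * w y)"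

abbreviation total_weight :: "(real \<times> 'a) list \<Rightarrow> real" where
  "total_weight v \<equiv> pairing (\<lambda>_. 1) v"

definition energy :: "('a \<Rightarrow> 'a \<Rightarrow> real) \<Rightarrow> (real \<times> 'a) list \<Rightarrow> real" where
  "energy g v = pairing (\<lambda>x. pairing (g x) v) v"

definition potential :: "('a \<Rightarrow> 'a \<Rightarrow> real) \<Rightarrow> 'a measure \<Rightarrow> 'a \<Rightarrow> real" where
  "potential g P y = (\<integral>x. g x y \<partial>P)"

lemma pairing_simps [simp]:
  "pairing w [] = 0"
  "pairing w ((b, y) # v) = b * w y + pairing w v"
  by (simp_all add: pairing_def)

lemma pairing_zero: "pairing (\<lambda>_. 0) v = 0"
  by (simp add: pairing_def case_prod_unfold)

lemma pairing_add: "pairing (\<lambda>y. w y + w' y) v = pairing w v + pairing w' v"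
  by (induction v) (auto simp: algebra_simps)

lemma pairing_scale: "pairing (\<lambda>y. c * w y) v = c * pairing w v"
  by (induction v) (auto simp: algebra_simps)

lemma pairing_conv_sum:
  "pairing w v = (\<Sum>i<length v. fst (v ! i) * w (snd (v ! i)))"
  by (simp add: pairing_def sum_list_sum_nth case_prod_unfold atLeast0LessThan)

lemma energy_Cons:
  assumes "\<And>x y. g x y = g y x"
  shows "energy g ((c, x) # v) = energy g v + 2 * c * pairing (g x) v + c\<^sup>2 * g x x"
proof -
  have "(\<lambda>y. g y x) = g x" using assms by auto
  then show ?thesis
    by (simp add: energy_def pairing_add pairing_scale power2_eq_square algebra_simps)
qed

lemma negative_definite_kernel_sym:
  "negative_definite_kernel g \<Longrightarrow> g x y = g y x"
  by (simp add: negative_definite_kernel_def)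

text \<open>The list form of negative definiteness. The pointwise inequalities for the kernel below are
  instances of it for suitable short lists.\<close>

lemma energy_nonpos:
  assumes "negative_definite_kernel g" and "total_weight v = 0"
  shows "energy g v \<le> 0"
proof (cases "v = []")
  case False
  have "energy g v = (\<Sum>i<length v. \<Sum>j<length v.
      fst (v ! i) * fst (v ! j) * g (snd (v ! i)) (snd (v ! j)))"
    by (simp add: energy_def pairing_conv_sum sum_distrib_left mult.assoc)
  also have "\<dots> \<le> 0"
    using assms(1)[unfolded negative_definite_kernel_def, THEN conjunct2, rule_format,
        of "length v" "\<lambda>i. fst (v ! i)" "\<lambda>i. snd (v ! i)"] False assms(2)
    by (simp add: pairing_conv_sum)
  finally show ?thesis .
qed (simp add: energy_def)

lemma diagonal_bound:
  assumes "negative_definite_kernel g"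
  shows "g x x + g z z \<le> 2 * g x z"
  using energy_nonpos[OF assms, of "[(1, x), (-1, z)]"] negative_definite_kernel_sym[OF assms, of z x]
  by (simp add: energy_def)

text \<open>Passing through a base point \<open>z\<close> separates the variables. Integrated over \<open>x\<close>, this bounds
  the potential of a measure by a constant plus a multiple of a single section of the kernel.\<close>

lemma quasi_triangle:
  assumes "negative_definite_kernel g" and nonneg: "\<And>x y. 0 \<le> g x y"
  shows "g x y \<le> 2 * g x z + 2 * g y z"
  using energy_nonpos[OF assms(1), of "[(1, x), (1, y), (-2, z)]"]
    negative_definite_kernel_sym[OF assms(1), of z x] negative_definite_kernel_sym[OF assms(1), of z y]
    negative_definite_kernel_sym[OF assms(1), of y x] nonneg[of x x] nonneg[of y y] nonneg[of z z]
  by (simp add: energy_def algebra_simps)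

text \<open>Up to a term without \<open>x\<close>, the increment \<open>g x y' - g x y\<close> is an
  inner product of the weighted configurations \<open>x - y\<close> and \<open>y -
  y'\<close> for the form \<open>- energy g\<close>, which is positive semidefinite on
  configurations of total weight zero. The bound is the Cauchy-Schwarz inequality in its
  additive form with parameter \<open>t\<close>. The point of it is that the only dependence
  on \<open>x\<close> is through \<open>t * g x y\<close>, which is integrable in
  \<open>x\<close> and small for small \<open>t\<close>, whereas the other two terms vanish
  as \<open>y'\<close> tends to \<open>y\<close> for each fixed \<open>t\<close>.\<close>

lemma increment_bound:
  assumes nd: "negative_definite_kernel g" and nonneg: "\<And>x y. 0 \<le> g x y" and t: "0 < t"
  shows "\<bar>g x y' - g x y\<bar> \<le>
    \<bar>g y y' - g y y\<bar> + t * g x y + (2 * g y y' - g y y - g y' y') / (2 * t)"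
proof -
  let ?\<Delta> = "g x y - g x y' - g y y + g y y'"
  let ?\<rho> = "2 * g y y' - g y y - g y' y'"
  have sym: "g y x = g x y" "g y' x = g x y'" "g y' y = g y y'"
    using negative_definite_kernel_sym[OF nd] by auto
  \<comment> \<open>The sign of \<open>s\<close> is left free: \<open>s = t\<close> and \<open>s = - t\<close> together bound the absolute value of \<open>?\<Delta>\<close>.\<close>
  have *: "2 * s * ?\<Delta> \<le> s\<^sup>2 * (2 * g x y) + ?\<rho>" for s
  proof -
    have "energy g [(s, x), (- s, y), (1, y), (- 1, y')] \<le> 0"
      by (rule energy_nonpos[OF nd]) simp
    moreover have "energy g [(s, x), (- s, y), (1, y), (- 1, y')] =
        s\<^sup>2 * (g x x + g y y - 2 * g x y) - ?\<rho> + 2 * s * ?\<Delta>"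
      by (simp add: energy_def sym power2_eq_square algebra_simps)
    moreover have "s\<^sup>2 * (g x x + g y y - 2 * g x y) \<ge> s\<^sup>2 * (- (2 * g x y))"
      using nonneg[of x x] nonneg[of y y] by (intro mult_left_mono) auto
    ultimately show ?thesis by linarith
  qed
  have "2 * t * \<bar>?\<Delta>\<bar> \<le> t\<^sup>2 * (2 * g x y) + ?\<rho>"
    using *[of t] *[of "- t"] t by (cases "?\<Delta> \<ge> 0") (auto simp: abs_if algebra_simps)
  then have "\<bar>?\<Delta>\<bar> \<le> t * g x y + ?\<rho> / (2 * t)"
    using t by (simp add: field_simps power2_eq_square)
  then show ?thesis by linarith
qed

section \<open>Potentials of measures of finite energy\<close>

locale nonneg_nd_kernel =
  fixes g :: "'a::topological_space \<Rightarrow> 'a \<Rightarrow> real"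
  assumes nonneg: "\<And>x y. 0 \<le> g x y"
    and cont: "continuous_on UNIV (\<lambda>(x, y). g x y)"
    and nd: "negative_definite_kernel g"
begin

definition finite_energy_measures :: "'a measure set" where
  "finite_energy_measures = {P \<in> borel_prob_measures. pair_expectation g P P < \<infinity>}"

lemma kernel_sym: "g x y = g y x"
  using negative_definite_kernel_sym[OF nd] .

lemma continuous_kernel:
  assumes "continuous_on UNIV f" and "continuous_on UNIV f'"
  shows "continuous_on UNIV (\<lambda>x. g (f x) (f' x))"
  using continuous_on_compose2[OF cont continuous_on_Pair[OF assms]] by simp

lemma finite_energy_prob_space: "P \<in> finite_energy_measures \<Longrightarrow> prob_space P"
  by (simp add: finite_energy_measures_def borel_prob_measures_def)

lemma continuous_imp_measurable:
  assumes "P \<in> finite_energy_measures" and "continuous_on UNIV f"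
  shows "f \<in> borel_measurable P"
proof -
  have "sets P = sets borel"
    using assms by (simp add: finite_energy_measures_def borel_prob_measures_def)
  then show ?thesis
    using measurable_cong_sets[OF _ refl] borel_measurable_continuous_onI[OF assms(2)] by blast
qed

lemma integrable_section:
  assumes "P \<in> finite_energy_measures"
  shows "integrable P (\<lambda>x. g x y)"
  using assms integrable_kernel_section[OF _ nonneg cont nd]
  by (simp add: finite_energy_measures_def)

lemma integrable_diagonal:
  assumes P: "P \<in> finite_energy_measures"
  shows "integrable P (\<lambda>x. g x x)"
proof (rule Bochner_Integration.integrable_bound)
  \<comment> \<open>Any base point serves for the comparison; \<open>undefined\<close> is just some element of the space.\<close>
  show "integrable P (\<lambda>x. 2 * g x undefined)" using integrable_section[OF P] by simp
  show "(\<lambda>x. g x x) \<in> borel_measurable P"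
    by (intro continuous_imp_measurable[OF P] continuous_kernel continuous_on_id)
  show "AE x in P. norm (g x x) \<le> norm (2 * g x undefined)"
  proof (rule AE_I2)
    fix x
    show "norm (g x x) \<le> norm (2 * g x undefined)"
      using diagonal_bound[OF nd, of x undefined] nonneg[of x x] nonneg[of undefined undefined]
        nonneg[of x undefined]
      by (simp only: real_norm_def)
  qed
qed

lemma potential_nonneg: "0 \<le> potential g P y"
  unfolding potential_def by (simp add: nonneg)

lemma potential_increment_bound:
  assumes P: "P \<in> finite_energy_measures" and t: "0 < t"
  shows "\<bar>potential g P y' - potential g P y\<bar> \<le>
    \<bar>g y y' - g y y\<bar> + t * potential g P y + (2 * g y y' - g y y - g y' y') / (2 * t)"
proof -
  interpret P: prob_space P using finite_energy_prob_space[OF P] .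
  note int [simp] = integrable_section[OF P]
  let ?c = "(2 * g y y' - g y y - g y' y') / (2 * t)"
  have "\<bar>potential g P y' - potential g P y\<bar> = \<bar>\<integral>x. g x y' - g x y \<partial>P\<bar>"
    by (simp add: potential_def)
  also have "\<dots> \<le> (\<integral>x. \<bar>g x y' - g x y\<bar> \<partial>P)"
    by (rule integral_abs_bound)
  also have "\<dots> \<le> (\<integral>x. \<bar>g y y' - g y y\<bar> + t * g x y + ?c \<partial>P)"
    by (intro integral_mono increment_bound nd nonneg t) auto
  also have "\<dots> = \<bar>g y y' - g y y\<bar> + t * potential g P y + ?c"
    by (simp add: potential_def P.prob_space del: add_divide_distrib)
  finally show ?thesis .
qed

text \<open>Given \<open>\<epsilon>\<close>, the parameter \<open>t\<close> is fixed first, so that the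
  term \<open>t * potential g P y\<close> of the increment bound is below
  \<open>\<epsilon>\<close>; the full bound is continuous in \<open>y'\<close> and takes
  exactly this value at \<open>y' = y\<close>, so it stays below \<open>\<epsilon>\<close>
  near \<open>y\<close>.\<close>

lemma continuous_potential:
  assumes P: "P \<in> finite_energy_measures"
  shows "continuous_on UNIV (potential g P)"
  unfolding continuous_on_def
proof (intro ballI tendstoI)
  fix y :: 'a and \<epsilon> :: real
  assume \<epsilon>: "0 < \<epsilon>"
  define t where "t = \<epsilon> / (2 * (potential g P y + 1))"
  have pos: "0 < potential g P y + 1" using potential_nonneg[of P y] by simp
  have t: "0 < t" "t * potential g P y < \<epsilon>"
  proof -
    show "0 < t" using pos \<epsilon> by (simp add: t_def)
    show "t * potential g P y < \<epsilon>"
      using pos \<epsilon> potential_nonneg[of P y] by (simp add: t_def field_simps)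
        (smt (verit) mult_nonneg_nonneg)
  qed
  let ?B = "\<lambda>y'. \<bar>g y y' - g y y\<bar> + t * potential g P y + (2 * g y y' - g y y - g y' y') / (2 * t)"
  have "continuous_on UNIV ?B"
    using t by (intro continuous_intros continuous_kernel) auto
  then have "(?B \<longlongrightarrow> ?B y) (at y)"
    unfolding continuous_on_def by blast
  then have "\<forall>\<^sub>F y' in at y. ?B y' < \<epsilon>"
    by (rule order_tendstoD) (use t in simp)
  then show "\<forall>\<^sub>F y' in at y. dist (potential g P y') (potential g P y) < \<epsilon>"
    unfolding dist_real_def
    by (rule eventually_mono) (rule le_less_trans[OF potential_increment_bound[OF P t(1)]])
qed

lemma integrable_potential:
  assumes P: "P \<in> finite_energy_measures" and Q: "Q \<in> finite_energy_measures"
  shows "integrable Q (potential g P)"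
proof (rule Bochner_Integration.integrable_bound)
  interpret P: prob_space P using finite_energy_prob_space[OF P] .
  interpret Q: prob_space Q using finite_energy_prob_space[OF Q] .
  let ?b = "\<lambda>y. 2 * potential g P undefined + 2 * g y undefined"
  show "integrable Q ?b" using integrable_section[OF Q] by simp
  show "potential g P \<in> borel_measurable Q"
    by (rule continuous_imp_measurable[OF Q continuous_potential[OF P]])
  have "potential g P y \<le> ?b y" for y
  proof -
    have "potential g P y \<le> (\<integral>x. 2 * g x undefined + 2 * g y undefined \<partial>P)"
      unfolding potential_def
      by (intro integral_mono quasi_triangle nd nonneg) (simp_all add: integrable_section[OF P])
    also have "\<dots> = ?b y"
      by (simp add: potential_def integrable_section[OF P] P.prob_space)
    finally show ?thesis .
  qed
  then show "AE y in Q. norm (potential g P y) \<le> norm (?b y)"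
    by (intro AE_I2) (simp add: potential_nonneg nonneg)
qed

lemma pair_expectation_eq_integral_potential:
  assumes P: "P \<in> finite_energy_measures" and Q: "Q \<in> finite_energy_measures"
  shows "pair_expectation g P Q = ennreal (\<integral>y. potential g P y \<partial>Q)"
  unfolding pair_expectation_def
  using integrable_section[OF P] integrable_potential[OF P Q]
  by (simp add: nn_integral_eq_integral nonneg potential_nonneg flip: potential_def)

section \<open>Averaging over random points\<close>

lemma integral_pairing:
  assumes P: "P \<in> finite_energy_measures"
  shows "integrable P (\<lambda>x. pairing (g x) v)"
    and "(\<integral>x. pairing (g x) v \<partial>P) = pairing (potential g P) v"
proof -
  have "integrable P (\<lambda>x. pairing (g x) v) \<and>
    (\<integral>x. pairing (g x) v \<partial>P) = pairing (potential g P) v"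
  proof (induction v)
    case (Cons p v)
    then show ?case
      using integrable_section[OF P] by (cases p) (simp add: potential_def)
  qed simp
  then show "integrable P (\<lambda>x. pairing (g x) v)"
    "(\<integral>x. pairing (g x) v \<partial>P) = pairing (potential g P) v" by auto
qed

text \<open>An inequality that holds for all configurations of total weight \<open>s\<close> holds in
  particular for \<open>(c, x) # v\<close>, where \<open>v\<close> has total weight \<open>s
  - c\<close>, and may be integrated over \<open>x\<close>. The cross terms between
  \<open>x\<close> and \<open>v\<close> turn into a pairing of \<open>v\<close> with the
  potential of \<open>P\<close>, so the averaged inequality has the same shape as the
  original one, with a new function \<open>w\<close> and a new constant \<open>C\<close>.
  That is what allows the step to be repeated.\<close>

lemma average_one_point:
  assumes P: "P \<in> finite_energy_measures" and w: "integrable P w"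
    and le: "\<And>v. total_weight v = s \<Longrightarrow> energy g v + pairing w v + C \<le> 0"
    and v: "total_weight v = s - c"
  shows "energy g v + pairing (\<lambda>y. w y + 2 * c * potential g P y) v
    + (C + c * (\<integral>x. w x \<partial>P) + c\<^sup>2 * (\<integral>x. g x x \<partial>P)) \<le> 0"
proof -
  interpret P: prob_space P using finite_energy_prob_space[OF P] .
  let ?F = "\<lambda>x. energy g v + 2 * c * pairing (g x) v + c\<^sup>2 * g x x + (c * w x + pairing w v) + C"
  have "?F x \<le> 0" for x
    using le[of "(c, x) # v"] v by (simp add: energy_Cons[OF kernel_sym])
  then have "(\<integral>x. ?F x \<partial>P) \<le> (\<integral>x. 0 \<partial>P)"
    by (intro integral_mono) (simp_all add: w integral_pairing[OF P] integrable_diagonal[OF P])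
  also have "(\<integral>x. ?F x \<partial>P) = energy g v + 2 * c * pairing (potential g P) v
      + c\<^sup>2 * (\<integral>x. g x x \<partial>P) + (c * (\<integral>x. w x \<partial>P) + pairing w v) + C"
    by (simp add: w integral_pairing[OF P] integrable_diagonal[OF P] P.prob_space)
  finally show ?thesis
    by (simp add: pairing_add pairing_scale algebra_simps)
qed

text \<open>Each new point meets the points that have been averaged before through the potential in
  \<open>w\<close>; the \<open>n (n - 1)\<close> ordered pairs of distinct random points
  account for the last term.\<close>

lemma average_many_points:
  assumes P: "P \<in> finite_energy_measures" and w: "integrable P w"
    and le: "\<And>v. total_weight v = s \<Longrightarrow> energy g v + pairing w v + C \<le> 0"
    and v: "total_weight v = s - real n * c"
  shows "energy g v + pairing (\<lambda>y. w y + 2 * real n * c * potential g P y) v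
    + (C + real n * c * (\<integral>x. w x \<partial>P) + real n * c\<^sup>2 * (\<integral>x. g x x \<partial>P)
       + real n * (real n - 1) * c\<^sup>2 * (\<integral>x. potential g P x \<partial>P)) \<le> 0"
  using v
proof (induction n arbitrary: v)
  case 0
  then show ?case using le by simp
next
  case (Suc n)
  let ?w = "\<lambda>y. w y + 2 * real n * c * potential g P y"
  have int: "integrable P ?w" using w integrable_potential[OF P P] by simp
  have "total_weight v = s - real n * c - c" using Suc.prems by (simp add: algebra_simps)
  from average_one_point[OF P int Suc.IH this]
  have "energy g v + pairing (\<lambda>y. ?w y + 2 * c * potential g P y) v
     + ((C + real n * c * (\<integral>x. w x \<partial>P) + real n * c\<^sup>2 * (\<integral>x. g x x \<partial>P)
       + real n * (real n - 1) * c\<^sup>2 * (\<integral>x. potential g P x \<partial>P))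
       + c * ((\<integral>x. w x \<partial>P) + 2 * real n * c * (\<integral>x. potential g P x \<partial>P))
       + c\<^sup>2 * (\<integral>x. g x x \<partial>P)) \<le> 0"
    using w integrable_potential[OF P P] by simp
  then show ?case
    by (simp add: pairing_add pairing_scale algebra_simps power2_eq_square)
qed

text \<open>Starting from negative definiteness (\<open>s\<close>, \<open>w\<close> and \<open>C\<close>
  all zero), \<open>n\<close> points of weight 1 are averaged over \<open>P\<close> and then
  \<open>n\<close> points of weight -1 over \<open>Q\<close>, after which the configuration
  left over is empty.\<close>

lemma energy_distance_nonneg:
  assumes P: "P \<in> finite_energy_measures" and Q: "Q \<in> finite_energy_measures"
  shows "(\<integral>y. potential g P y \<partial>P) + (\<integral>y. potential g Q y \<partial>Q) \<le> 2 * (\<integral>y. potential g P y \<partial>Q)"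
proof (rule ccontr)
  let ?P = "\<integral>y. potential g P y \<partial>P" and ?Q = "\<integral>y. potential g Q y \<partial>Q"
  let ?PQ = "\<integral>y. potential g P y \<partial>Q"
  let ?D = "\<lambda>R. \<integral>x. g x x \<partial>R"
  assume "\<not> ?thesis"
  then have gap: "0 < ?P + ?Q - 2 * ?PQ" by simp
  have bound: "real n * (?P + ?Q - 2 * ?PQ) \<le> ?P + ?Q - ?D P - ?D Q" if n: "0 < n" for n
  proof -
    have *: "energy g v + pairing (\<lambda>y. 2 * real n * potential g P y) v
        + (real n * ?D P + real n * (real n - 1) * ?P) \<le> 0" if "total_weight v = - real n" for v
      using average_many_points[OF P, of "\<lambda>_. 0" 0 0 v n 1] energy_nonpos[OF nd] that
      by (simp add: pairing_zero)
    have int: "integrable Q (\<lambda>y. 2 * real n * potential g P y)"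
      using integrable_potential[OF P Q] by simp
    have "real n * ?D P + real n * (real n - 1) * ?P - real n * (2 * real n * ?PQ)
        + real n * ?D Q + real n * (real n - 1) * ?Q \<le> 0"
      using average_many_points[OF Q int *, where v = "[]" and s = "- real n" and n = n and c = "-1"] by (simp add: energy_def)
    then have "real n * (real n * (?P + ?Q - 2 * ?PQ)) \<le> real n * (?P + ?Q - ?D P - ?D Q)"
      by (simp add: algebra_simps)
    then show ?thesis using n by simp
  qed
  obtain n where n: "\<bar>?P + ?Q - ?D P - ?D Q\<bar> < real n * (?P + ?Q - 2 * ?PQ)"
    using reals_Archimedean3[OF gap] by blast
  then have "0 < n" by (cases n) auto
  from bound[OF this] n show False by linarith
qed

end

section \<open>Propriety of the score\<close>

lemma antimono_convex_tangent_bound: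
  fixes h :: "real \<Rightarrow> real"
  assumes anti: "antimono_on {0<..} h" and conv: "convex_on {0<..} h"
    and diff: "h differentiable_on {0<..}"
    and d: "0 < d" and e: "0 < e" and m: "d + e \<le> 2 * m"
  shows "h d + 2 * deriv h d * (m - d) \<le> h e"
proof -
  have "h differentiable at d"
    using diff d by (simp add: differentiable_on_eq_differentiable_at)
  then have D: "(h has_real_derivative deriv h d) (at d)"
    by (simp add: DERIV_deriv_iff_real_differentiable)
  have "mono_on {0<..} (\<lambda>x. - h x)"
    using anti by (auto simp: monotone_on_def)
  then have "0 \<le> - deriv h d"
    by (rule mono_on_imp_deriv_nonneg) (use d D in \<open>auto intro: DERIV_minus simp: interior_open\<close>)
  then have "deriv h d * (2 * (m - d)) \<le> deriv h d * (e - d)"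
    using m by (intro mult_left_mono_neg) auto
  moreover have "h e - h d \<ge> deriv h d * (e - d)"
    by (rule convex_on_imp_above_tangent[OF conv]) (use d e D in \<open>auto simp: interior_open intro: has_field_derivative_at_within\<close>)
  ultimately show ?thesis by (simp add: algebra_simps)
qed

theorem theorem3:
  fixes g :: "'a::t2_space \<Rightarrow> 'a \<Rightarrow> real" and h :: "real \<Rightarrow> real"
  assumes "\<And>x y. 0 \<le> g x y"
    and "continuous_on UNIV (\<lambda>(x, y). g x y)"
    and "negative_definite_kernel g"
    and "antimono_on {0<..} h"
    and "convex_on {0<..} h"
    and "h differentiable_on {0<..}"
  shows "proper_scoring_rule (kernel_score h g)
           {P \<in> borel_prob_measures. 0 < pair_expectation g P P \<and> pair_expectation g P P < \<infinity>}"
proof -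
  interpret nonneg_nd_kernel g
    using assms(1-3) by unfold_locales
  let ?\<P> = "{P \<in> borel_prob_measures. 0 < pair_expectation g P P \<and> pair_expectation g P P < \<infinity>}"
  define e where "e P = (\<integral>y. potential g P y \<partial>P)" for P
  have fin: "P \<in> finite_energy_measures" if "P \<in> ?\<P>" for P
    using that by (simp add: finite_energy_measures_def)
  have e_nonneg: "0 \<le> e P" for P
    by (simp add: e_def potential_nonneg)
  have pe: "pair_expectation g P P = ennreal (e P)" if "P \<in> ?\<P>" for P
    unfolding e_def by (rule pair_expectation_eq_integral_potential[OF fin[OF that] fin[OF that]])
  have e_pos: "0 < e P" if "P \<in> ?\<P>" for P
    using pe[OF that] that by simp
  have score: "kernel_score h g P = (\<lambda>y. h (e P) + 2 * deriv h (e P) * (potential g P y - e P))"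
    if "P \<in> ?\<P>" for P
    by (simp add: kernel_score_def Let_def pe[OF that] e_nonneg potential_def fun_eq_iff)
  have expected: "expected_score (kernel_score h g) P Q =
      h (e P) + 2 * deriv h (e P) * ((\<integral>y. potential g P y \<partial>Q) - e P)"
    if "P \<in> ?\<P>" "Q \<in> ?\<P>" for P Q
  proof -
    interpret Q: prob_space Q using finite_energy_prob_space[OF fin[OF that(2)]] .
    show ?thesis
      using integrable_potential[OF fin[OF that(1)] fin[OF that(2)]]
      by (simp add: expected_score_def score[OF that(1)] Q.prob_space)
  qed
  show ?thesis
    unfolding proper_scoring_rule_def
  proof (intro ballI conjI)
    fix P Q assume P: "P \<in> ?\<P>" and Q: "Q \<in> ?\<P>"
    interpret Q: prob_space Q using finite_energy_prob_space[OF fin[OF Q]] .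
    show "integrable Q (kernel_score h g P)"
      using integrable_potential[OF fin[OF P] fin[OF Q]] by (simp add: score[OF P])
    have "e P + e Q \<le> 2 * (\<integral>y. potential g P y \<partial>Q)"
      using energy_distance_nonneg[OF fin[OF P] fin[OF Q]] by (simp add: e_def)
    then have "h (e P) + 2 * deriv h (e P) * ((\<integral>y. potential g P y \<partial>Q) - e P) \<le> h (e Q)"
      by (rule antimono_convex_tangent_bound[OF assms(4-6) e_pos[OF P] e_pos[OF Q]])
    then show "expected_score (kernel_score h g) P Q \<le> expected_score (kernel_score h g) Q Q"
      by (simp add: expected[OF P Q] expected[OF Q Q] flip: e_def)
  qed
qed

end
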